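(* The metric $f$-manifold $(\mathrm{U}(3),\phi,\xi_1,\xi_2,\xi_3,\eta_1,\eta_2,\eta_3,g)$ described in the context is normal.
   Context: Let $E_{ij}$ be the elementary $3\times3$ matrices. On the Lie group $\mathrm{U}(3)$ let $X_{ij},Y_{ij}$ for $(ij)\in\{(12),(13),(23)\}$ and $\xi_1,\xi_2,\xi_3$ be the left-invariant vector fields with values at the identity $X_{ij}=E_{ij}-E_{ji}$, $Y_{ij}=\sqrt{-1}(E_{ij}+E_{ji})$, $\xi_i=\sqrt{-1}E_{ii}$. Let $g$ be the left-invariant Riemannian metric making $\{X_{12},Y_{12},X_{13},Y_{13},X_{23},Y_{23},\xi_1,\xi_2,\xi_3\}$ orthonormal, let $\eta_i=g(\xi_i,\cdot)$, and let $\phi$ be the left-invariant endomorphism with $\phi(X_{ij})=Y_{ij}$, $\phi(Y_{ij})=-X_{ij}$ for $(ij)=(12),(13),(23)$ and $\phi(\xi_i)=0$ for $i=1,2,3$. Then $\ker\phi=\langle\xi_1,\xi_2,\xi_3\rangle$, $\eta_i(\xi_j)=\delta_{ij}$, $\eta_i\circ\phi=0$, $\phi^2=-\mathrm{Id}+\sum_i\eta_i\otimes\xi_i$ and $g(\phi X,\phi Y)=g(X,Y)-\sum_i\eta_i(X)\eta_i(Y)$, i.e. this is a metric $f$-structure. It is called normal if $N^{(1)}:=N_\phi+\sum_{i=1}^{3}d\eta_i\otimes\xi_i$ vanishes identically, where $N_\phi(X,Y)=[\phi X,\phi Y]+\phi^2[X,Y]-\phi[X,\phi Y]-\phi[\phi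 X,Y]$ and $d\eta(X,Y)=X\eta(Y)-Y\eta(X)-\eta([X,Y])$. *)

theory Defs
  imports "HOL-Analysis.Analysis"
begin

section \<open>Calculus on embedded submanifolds of a Euclidean space\<close>

text \<open>A manifold is represented by the set \<open>M\<close> of its points in a Euclidean space; the notions
  below have their usual meaning when \<open>M\<close> is an embedded submanifold. A vector field is a
  function from points to vectors, a 1-form takes a point and a tangent vector, and so on;
  values at points outside \<open>M\<close> are irrelevant.\<close>

primrec Ck_on ::
  "nat \<Rightarrow> 'a::euclidean_space set \<Rightarrow> ('a \<Rightarrow> 'b::real_normed_vector) \<Rightarrow> bool" where
  "Ck_on 0 W f \<longleftrightarrow> continuous_on W f"
| "Ck_on (Suc k) W f \<longleftrightarrow> (\<forall>x\<in>W. f differentiable (at x)) \<and>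
     (\<forall>v. Ck_on k W (\<lambda>x. frechet_derivative f (at x) v))"

definition smooth_on :: "'a::euclidean_space set \<Rightarrow> ('a \<Rightarrow> 'b::real_normed_vector) \<Rightarrow> bool" where
  "smooth_on M f \<longleftrightarrow>
     (\<forall>p\<in>M. \<exists>W h. open W \<and> p \<in> W \<and> (\<forall>k. Ck_on k W h) \<and> (\<forall>q\<in>M \<inter> W. h q = f q))"

text \<open>Requiring the curves to be differentiable at \<open>0\<close> only gives the same tangent vectors as
  requiring them to be smooth if \<open>M\<close> is an embedded submanifold. For the unitary group the
  tangent spaces are determined in \<open>tangent_space_unitary\<close>.\<close>

definition tangent_space :: "'a::euclidean_space set \<Rightarrow> 'a \<Rightarrow> 'a set" where
  "tangent_space M p =
     {v. \<exists>c::real \<Rightarrow> 'a. (\<forall>t. c t \<in> M) \<and> c 0 = p \<and> (c has_vector_derivative v) (at 0)}"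

text \<open>The derivative of \<open>f\<close> at \<open>p\<close> in the direction of a tangent vector \<open>v\<close> of \<open>M\<close>. The
  derivative within \<open>M\<close> is in general not unique as a linear map on the ambient space, but it is
  on tangent vectors; see \<open>dir_deriv_eq\<close>.\<close>

definition dir_deriv ::
  "'a::euclidean_space set \<Rightarrow> ('a \<Rightarrow> 'b::real_normed_vector) \<Rightarrow> 'a \<Rightarrow> 'a \<Rightarrow> 'b" where
  "dir_deriv M f p v = frechet_derivative f (at p within M) v"

definition vector_field :: "'a::euclidean_space set \<Rightarrow> ('a \<Rightarrow> 'a) \<Rightarrow> bool" where
  "vector_field M X \<longleftrightarrow> smooth_on M X \<and> (\<forall>p\<in>M. X p \<in> tangent_space M p)"

text \<open>The coordinate formula, in the coordinates of the ambient space, for the vector field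
  \<open>[X,Y]\<close> with \<open>[X,Y] f = X (Y f) - Y (X f)\<close>; see \<open>lie_bracket_unique\<close>.\<close>

definition lie_bracket ::
  "'a::euclidean_space set \<Rightarrow> ('a \<Rightarrow> 'a) \<Rightarrow> ('a \<Rightarrow> 'a) \<Rightarrow> 'a \<Rightarrow> 'a" where
  "lie_bracket M X Y p = dir_deriv M Y p (X p) - dir_deriv M X p (Y p)"

lemma dir_deriv_eq:
  assumes "p \<in> M" and v: "v \<in> tangent_space M p" and f: "(f has_derivative f') (at p within M)"
  shows "dir_deriv M f p v = f' v"
proof -
  obtain c :: "real \<Rightarrow> 'a" where c: "\<And>t. c t \<in> M" "c 0 = p" "(c has_vector_derivative v) (at 0)"
    using v by (auto simp: tangent_space_def)
  have *: "((f \<circ> c) has_vector_derivative D v) (at 0)"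
    if "(f has_derivative D) (at p within M)" for D
  proof -
    have "(f has_derivative D) (at (c 0) within range c)"
      using that c by (auto intro: has_derivative_subset)
    from diff_chain_within[OF c(3)[unfolded has_vector_derivative_def] this]
    show ?thesis
      using linear_scale[OF has_derivative_linear[OF that]]
      by (simp add: has_vector_derivative_def o_def)
  qed
  have "(f has_derivative frechet_derivative f (at p within M)) (at p within M)"
    using f by (metis frechet_derivative_works differentiable_def)
  from *[OF this] *[OF f] show ?thesis
    unfolding dir_deriv_def by (rule vector_derivative_unique_at)
qed

lemma smooth_on_has_derivative:
  assumes "smooth_on M f" "p \<in> M"
  shows "\<exists>f'. (f has_derivative f') (at p within M)"
proof -
  obtain W h where W: "open W" "p \<in> W" "\<forall>k. Ck_on k W h" "\<forall>q\<in>M \<inter> W. h q = f q"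
    using assms(1)[unfolded smooth_on_def, rule_format, OF assms(2)] by auto
  have "h differentiable (at p)"
    using W(3)[rule_format, of "Suc 0"] W(2) by simp
  then obtain h' where "(h has_derivative h') (at p)"
    unfolding differentiable_def by (elim exE)
  then have h': "(h has_derivative h') (at p within M)"
    by (rule has_derivative_at_withinI)
  obtain d where d: "d > 0" "ball p d \<subseteq> W"
    using W(1,2) openE by blast
  have "h q = f q" if "q \<in> M" "dist q p < d" for q
    using that d(2) W(4) by (auto simp: dist_commute)
  then have "(f has_derivative h') (at p within M)"
    by (rule has_derivative_transform_within[OF h' d(1) assms(2)])
  then show ?thesis by (intro exI[of _ h'])
qed

lemma smooth_on_linear:
  fixes L :: "'a::euclidean_space \<Rightarrow> 'b::real_normed_vector"
  assumes "bounded_linear L"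
  shows "smooth_on M L"
proof -
  have const: "Ck_on k UNIV (\<lambda>x::'a. c)" for k and c :: 'b
    by (induction k arbitrary: c) (auto simp: frechet_derivative_const)
  have "(L has_derivative L) (at x)" for x
    using assms by (rule bounded_linear_imp_has_derivative)
  then have L: "L differentiable (at x)" "frechet_derivative L (at x) = L" for x
    by (auto simp: differentiable_def frechet_derivative_at[symmetric])
  have "Ck_on k UNIV L" for k
    by (cases k) (use assms const in \<open>simp_all add: L linear_continuous_on\<close>)
  then show ?thesis
    unfolding smooth_on_def by (intro ballI exI[of _ UNIV] exI[of _ L]) simp
qed

text \<open>The value at \<open>p\<close> of a vector field \<open>Z\<close> with \<open>Z f = X (Y f) - Y (X f)\<close> for all smooth
  functions \<open>f\<close> is the one of \<open>lie_bracket\<close>.\<close>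

lemma lie_bracket_unique:
  assumes X: "vector_field M X" and Y: "vector_field M Y" and p: "p \<in> M"
    and Z: "Z \<in> tangent_space M p"
    and eq: "\<And>f :: 'a::euclidean_space \<Rightarrow> real. smooth_on M f \<Longrightarrow>
        dir_deriv M f p Z = dir_deriv M (\<lambda>q. dir_deriv M f q (Y q)) p (X p)
          - dir_deriv M (\<lambda>q. dir_deriv M f q (X q)) p (Y p)"
  shows "Z = lie_bracket M X Y p"
proof (rule euclidean_eqI)
  fix b :: 'a
  have lin: "dir_deriv M (\<lambda>x. x \<bullet> b) q v = v \<bullet> b" if "q \<in> M" "v \<in> tangent_space M q" for q v
    using that by (intro dir_deriv_eq) (auto intro!: derivative_eq_intros)
  have comp: "dir_deriv M (\<lambda>q. dir_deriv M (\<lambda>x. x \<bullet> b) q (V q)) p v = dir_deriv M V p v \<bullet> b"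
    if V: "vector_field M V" and v: "v \<in> tangent_space M p" for V v
  proof -
    obtain V' where V': "(V has_derivative V') (at p within M)"
      using smooth_on_has_derivative[of M V p] V p by (auto simp: vector_field_def)
    have "((\<lambda>q. V q \<bullet> b) has_derivative (\<lambda>v. V' v \<bullet> b)) (at p within M)"
      using V' by (rule has_derivative_inner_left)
    then have "((\<lambda>q. dir_deriv M (\<lambda>x. x \<bullet> b) q (V q)) has_derivative (\<lambda>v. V' v \<bullet> b)) (at p within M)"
    proof (rule has_derivative_transform[OF p, rotated])
      show "dir_deriv M (\<lambda>x. x \<bullet> b) q (V q) = V q \<bullet> b" if "q \<in> M" for q
        using that V by (intro lin) (auto simp: vector_field_def)
    qed
    then show ?thesis
      by (simp add: dir_deriv_eq[OF p v] dir_deriv_eq[OF p v V'])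
  qed
  have "Z \<bullet> b = dir_deriv M (\<lambda>x. x \<bullet> b) p Z"
    using lin p Z by simp
  also have "\<dots> = dir_deriv M Y p (X p) \<bullet> b - dir_deriv M X p (Y p) \<bullet> b"
    using eq[OF smooth_on_linear[OF bounded_linear_inner_left], of b] X Y p
    by (simp add: comp vector_field_def)
  also have "\<dots> = lie_bracket M X Y p \<bullet> b"
    by (simp add: lie_bracket_def inner_diff_left)
  finally show "Z \<bullet> b = lie_bracket M X Y p \<bullet> b" .
qed

definition ext_deriv ::
  "'a::euclidean_space set \<Rightarrow> ('a \<Rightarrow> 'a \<Rightarrow> real) \<Rightarrow> ('a \<Rightarrow> 'a) \<Rightarrow> ('a \<Rightarrow> 'a) \<Rightarrow> 'a \<Rightarrow> real" where
  "ext_deriv M \<eta> X Y p =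
     dir_deriv M (\<lambda>q. \<eta> q (Y q)) p (X p) - dir_deriv M (\<lambda>q. \<eta> q (X q)) p (Y p)
       - \<eta> p (lie_bracket M X Y p)"

definition tangent_linear ::
  "'a::euclidean_space set \<Rightarrow> 'a \<Rightarrow> ('a \<Rightarrow> 'b::real_vector) \<Rightarrow> bool" where
  "tangent_linear M p \<alpha> \<longleftrightarrow>
     (\<forall>u\<in>tangent_space M p. \<forall>v\<in>tangent_space M p. \<forall>a b.
        \<alpha> (a *\<^sub>R u + b *\<^sub>R v) = a *\<^sub>R \<alpha> u + b *\<^sub>R \<alpha> v)"

definition endo_field :: "'a::euclidean_space set \<Rightarrow> ('a \<Rightarrow> 'a \<Rightarrow> 'a) \<Rightarrow> bool" where
  "endo_field M \<phi> \<longleftrightarrow>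
     (\<forall>p\<in>M. tangent_linear M p (\<phi> p) \<and> \<phi> p ` tangent_space M p \<subseteq> tangent_space M p) \<and>
     (\<forall>X. vector_field M X \<longrightarrow> vector_field M (\<lambda>p. \<phi> p (X p)))"

definition one_form :: "'a::euclidean_space set \<Rightarrow> ('a \<Rightarrow> 'a \<Rightarrow> real) \<Rightarrow> bool" where
  "one_form M \<eta> \<longleftrightarrow>
     (\<forall>p\<in>M. tangent_linear M p (\<eta> p)) \<and>
     (\<forall>X. vector_field M X \<longrightarrow> smooth_on M (\<lambda>p. \<eta> p (X p)))"

definition riemannian_metric :: "'a::euclidean_space set \<Rightarrow> ('a \<Rightarrow> 'a \<Rightarrow> 'a \<Rightarrow> real) \<Rightarrow> bool" where
  "riemannian_metric M g \<longleftrightarrow>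
     (\<forall>p\<in>M. \<forall>u\<in>tangent_space M p.
        tangent_linear M p (g p u) \<and> (\<forall>v\<in>tangent_space M p. g p u v = g p v u) \<and>
        (u \<noteq> 0 \<longrightarrow> g p u u > 0)) \<and>
     (\<forall>X Y. vector_field M X \<longrightarrow> vector_field M Y \<longrightarrow> smooth_on M (\<lambda>p. g p (X p) (Y p)))"

section \<open>Metric f-structures and normality\<close>

definition metric_f_structure ::
  "'a::euclidean_space set \<Rightarrow> ('a \<Rightarrow> 'a \<Rightarrow> 'a) \<Rightarrow> ('i::finite \<Rightarrow> 'a \<Rightarrow> 'a) \<Rightarrow>
   ('i \<Rightarrow> 'a \<Rightarrow> 'a \<Rightarrow> real) \<Rightarrow> ('a \<Rightarrow> 'a \<Rightarrow> 'a \<Rightarrow> real) \<Rightarrow> bool" where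
  "metric_f_structure M \<phi> \<xi> \<eta> g \<longleftrightarrow>
     endo_field M \<phi> \<and> (\<forall>i. vector_field M (\<xi> i)) \<and> (\<forall>i. one_form M (\<eta> i)) \<and>
     riemannian_metric M g \<and>
     (\<forall>p\<in>M.
        {v \<in> tangent_space M p. \<phi> p v = 0} = span (range (\<lambda>i. \<xi> i p)) \<and>
        (\<forall>i j. \<eta> i p (\<xi> j p) = (if i = j then 1 else 0)) \<and>
        (\<forall>v\<in>tangent_space M p.
           (\<forall>i. \<eta> i p (\<phi> p v) = 0) \<and>
           \<phi> p (\<phi> p v) = - v + (\<Sum>i\<in>UNIV. \<eta> i p v *\<^sub>R \<xi> i p)) \<and>
        (\<forall>u\<in>tangent_space M p. \<forall>v\<in>tangent_space M p.
           g p (\<phi> p u) (\<phi> p v) = g p u v - (\<Sum>i\<in>UNIV. \<eta> i p u * \<eta> i p v)))"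

definition nijenhuis ::
  "'a::euclidean_space set \<Rightarrow> ('a \<Rightarrow> 'a \<Rightarrow> 'a) \<Rightarrow> ('a \<Rightarrow> 'a) \<Rightarrow> ('a \<Rightarrow> 'a) \<Rightarrow> 'a \<Rightarrow> 'a" where
  "nijenhuis M \<phi> X Y p =
     lie_bracket M (\<lambda>q. \<phi> q (X q)) (\<lambda>q. \<phi> q (Y q)) p
       + \<phi> p (\<phi> p (lie_bracket M X Y p))
       - \<phi> p (lie_bracket M X (\<lambda>q. \<phi> q (Y q)) p)
       - \<phi> p (lie_bracket M (\<lambda>q. \<phi> q (X q)) Y p)"

definition N1 ::
  "'a::euclidean_space set \<Rightarrow> ('a \<Rightarrow> 'a \<Rightarrow> 'a) \<Rightarrow> ('i::finite \<Rightarrow> 'a \<Rightarrow> 'a) \<Rightarrow>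
   ('i \<Rightarrow> 'a \<Rightarrow> 'a \<Rightarrow> real) \<Rightarrow> ('a \<Rightarrow> 'a) \<Rightarrow> ('a \<Rightarrow> 'a) \<Rightarrow> 'a \<Rightarrow> 'a" where
  "N1 M \<phi> \<xi> \<eta> X Y p =
     nijenhuis M \<phi> X Y p + (\<Sum>i\<in>UNIV. ext_deriv M (\<eta> i) X Y p *\<^sub>R \<xi> i p)"

definition normal_f_structure ::
  "'a::euclidean_space set \<Rightarrow> ('a \<Rightarrow> 'a \<Rightarrow> 'a) \<Rightarrow> ('i::finite \<Rightarrow> 'a \<Rightarrow> 'a) \<Rightarrow>
   ('i \<Rightarrow> 'a \<Rightarrow> 'a \<Rightarrow> real) \<Rightarrow> bool" where
  "normal_f_structure M \<phi> \<xi> \<eta> \<longleftrightarrow>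
     (\<forall>X Y. vector_field M X \<longrightarrow> vector_field M Y \<longrightarrow> (\<forall>p\<in>M. N1 M \<phi> \<xi> \<eta> X Y p = 0))"

section \<open>The unitary group U(3)\<close>

definition ctranspose :: "complex^'n^'m \<Rightarrow> complex^'m^'n" where
  "ctranspose A = (\<chi> i j. cnj (A $ j $ i))"

definition unitary_group :: "(complex^'n^'n) set" where
  "unitary_group = {A. ctranspose A ** A = mat 1 \<and> A ** ctranspose A = mat 1}"

definition skew_hermitian :: "(complex^'n^'n) set" where
  "skew_hermitian = {A. ctranspose A = - A}"

lemma ctranspose_mult: "ctranspose (A ** B) = ctranspose B ** ctranspose A"
  by (simp add: ctranspose_def matrix_matrix_mult_def vec_eq_iff mult.commute)

lemma ctranspose_ctranspose [simp]: "ctranspose (ctranspose A) = A"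
  by (simp add: ctranspose_def vec_eq_iff)

lemma ctranspose_mat_1 [simp]: "ctranspose (mat 1) = mat 1"
  by (auto simp: ctranspose_def mat_def vec_eq_iff)

lemma ctranspose_add: "ctranspose (A + B) = ctranspose A + ctranspose B"
  by (simp add: ctranspose_def vec_eq_iff)

lemma ctranspose_diff: "ctranspose (A - B) = ctranspose A - ctranspose B"
  by (simp add: ctranspose_def vec_eq_iff)

lemma ctranspose_scaleR: "ctranspose (a *\<^sub>R A) = a *\<^sub>R ctranspose A"
  by (simp add: ctranspose_def vec_eq_iff)

lemma matrix_inv_unitary:
  assumes "A \<in> unitary_group"
  shows "matrix_inv A = ctranspose A"
proof -
  have "A ** matrix_inv A = mat 1 \<and> matrix_inv A ** A = mat 1"
    unfolding matrix_inv_def by (rule someI_ex) (use assms in \<open>auto simp: unitary_group_def\<close>)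
  then have "matrix_inv A ** (A ** ctranspose A) = ctranspose A"
    by (simp add: matrix_mul_assoc)
  then show ?thesis
    using assms by (simp add: unitary_group_def)
qed

lemma bounded_bilinear_matrix_mult:
  "bounded_bilinear ((**) :: complex^'n^'n \<Rightarrow> complex^'n^'n \<Rightarrow> complex^'n^'n)"
proof -
  have "linear ((**) A :: complex^'n^'n \<Rightarrow> complex^'n^'n)" for A :: "complex^'n^'n"
    by (intro linearI) (simp_all add: matrix_add_ldistrib matrix_scalar_ac scalar_matrix_assoc)
  moreover have "linear (\<lambda>A :: complex^'n^'n. A ** B)" for B :: "complex^'n^'n"
    by (intro linearI) (simp_all add: matrix_matrix_mult_def vec_eq_iff distrib_right
        sum.distrib scaleR_sum_right)
  ultimately show ?thesis
    by (simp add: bilinear_def bilinear_conv_bounded_bilinear[symmetric])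
qed

lemma inner_matrix_ctranspose:
  fixes K :: "complex^'n^'n"
  shows "x \<bullet> (K *v y) = (ctranspose K *v x) \<bullet> y"
proof -
  have "x \<bullet> (K *v y) = (\<Sum>i\<in>UNIV. \<Sum>j\<in>UNIV. x $ i \<bullet> (K $ i $ j * y $ j))"
    by (simp add: inner_vec_def matrix_vector_mult_def inner_sum_right)
  also have "\<dots> = (\<Sum>j\<in>UNIV. \<Sum>i\<in>UNIV. (cnj (K $ i $ j) * x $ i) \<bullet> y $ j)"
    by (subst sum.swap) (simp add: inner_complex_def algebra_simps)
  also have "\<dots> = (ctranspose K *v x) \<bullet> y"
    by (simp add: inner_vec_def matrix_vector_mult_def ctranspose_def inner_sum_left)
  finally show ?thesis .
qed

lemma cayley_unitary:
  fixes K :: "complex^'n^'n"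
  assumes K: "K \<in> skew_hermitian"
  obtains B where "B ** (mat 1 - K) = mat 1" "(mat 1 - K) ** B = mat 1"
    "(mat 1 + K) ** B \<in> unitary_group"
proof -
  interpret mm: bounded_bilinear "(**) :: complex^'n^'n \<Rightarrow> complex^'n^'n \<Rightarrow> complex^'n^'n"
    by (rule bounded_bilinear_matrix_mult)
  have "x = 0" if "(mat 1 - K) *v x = 0" for x
  proof -
    have x: "x = K *v x"
      using that by (simp add: matrix_vector_mult_diff_rdistrib)
    have "(- K) *v x = - (K *v x)"
      using matrix_vector_mult_diff_rdistrib[of 0 K x] by simp
    then have "x \<bullet> (K *v x) = - ((K *v x) \<bullet> x)"
      using K by (simp add: inner_matrix_ctranspose skew_hermitian_def)
    then show ?thesis
      using x by simp
  qed
  then obtain B where B: "B ** (mat 1 - K) = mat 1"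
    using matrix_left_invertible_ker[of "mat 1 - K"] by blast
  then have B': "(mat 1 - K) ** B = mat 1"
    by (simp add: matrix_left_right_inverse)
  have cB: "ctranspose B ** (mat 1 + K) = mat 1"
    using arg_cong[OF B', of ctranspose] K
    by (simp add: ctranspose_mult ctranspose_diff skew_hermitian_def)
  let ?C = "(mat 1 + K) ** B"
  have comm: "(mat 1 - K) ** (mat 1 + K) = (mat 1 + K) ** (mat 1 - K)"
    by (simp add: mm.add_left mm.add_right mm.diff_left mm.diff_right)
  have "ctranspose ?C ** ?C = ctranspose B ** ((mat 1 - K) ** (mat 1 + K)) ** B"
    using K by (simp add: ctranspose_mult ctranspose_add skew_hermitian_def matrix_mul_assoc)
  also have "\<dots> = (ctranspose B ** (mat 1 + K)) ** ((mat 1 - K) ** B)"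
    unfolding comm by (simp add: matrix_mul_assoc)
  also have "\<dots> = mat 1"
    by (simp add: cB B')
  finally have "?C \<in> unitary_group"
    by (simp add: unitary_group_def matrix_left_right_inverse)
  with B B' that show ?thesis by blast
qed

lemma unitary_mult:
  assumes A: "A \<in> unitary_group" and B: "B \<in> unitary_group"
  shows "A ** B \<in> unitary_group"
proof -
  have "ctranspose (A ** B) ** (A ** B) = ctranspose B ** (ctranspose A ** A) ** B"
    by (simp only: ctranspose_mult matrix_mul_assoc)
  also have "\<dots> = mat 1"
    using A B by (simp add: unitary_group_def)
  finally show ?thesis
    by (simp add: unitary_group_def matrix_left_right_inverse)
qed

lemma bounded_unitary: "bounded (unitary_group :: (complex^'n^'n) set)"
proof -
  have "norm A \<le> (\<Sum>i\<in>(UNIV::'n set). \<Sum>j\<in>(UNIV::'n set). 1)"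
    if A: "A \<in> unitary_group" for A :: "complex^'n^'n"
  proof -
    have "norm (A $ i $ j) \<le> 1" for i j
    proof -
      have "(\<Sum>k\<in>UNIV. A $ i $ k * cnj (A $ i $ k)) = 1"
        using A by (auto simp: unitary_group_def matrix_matrix_mult_def ctranspose_def mat_def
            vec_eq_iff)
      then have "complex_of_real (\<Sum>k\<in>UNIV. (cmod (A $ i $ k))\<^sup>2) = 1"
        by (simp add: complex_norm_square del: of_real_power)
      then have "(\<Sum>k\<in>UNIV. (cmod (A $ i $ k))\<^sup>2) = 1"
        using of_real_eq_1_iff by blast
      moreover have "(cmod (A $ i $ j))\<^sup>2 \<le> (\<Sum>k\<in>UNIV. (cmod (A $ i $ k))\<^sup>2)"
        by (rule member_le_sum) auto
      ultimately show ?thesis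
        by (simp add: power_le_one_iff)
    qed
    have "norm (A $ i) \<le> (\<Sum>j\<in>(UNIV::'n set). 1)" for i
    proof -
      have "norm (A $ i) \<le> (\<Sum>j\<in>UNIV. norm (A $ i $ j))"
        unfolding norm_vec_def[of "A $ i"] by (rule L2_set_le_sum) simp
      also have "\<dots> \<le> (\<Sum>j\<in>(UNIV::'n set). 1)"
        by (rule sum_mono) (simp add: \<open>\<And>i j. cmod (A $ i $ j) \<le> 1\<close>)
      finally show ?thesis .
    qed
    then have "(\<Sum>i\<in>UNIV. norm (A $ i)) \<le> (\<Sum>i\<in>(UNIV::'n set). \<Sum>j\<in>(UNIV::'n set). 1)"
      by (rule sum_mono)
    moreover have "norm A \<le> (\<Sum>i\<in>UNIV. norm (A $ i))"
      unfolding norm_vec_def[of A] by (rule L2_set_le_sum) simp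
    ultimately show ?thesis by linarith
  qed
  then show ?thesis by (auto simp: bounded_iff)
qed

lemma tangent_space_unitary:
  fixes A :: "complex^'n^'n"
  assumes A: "A \<in> unitary_group"
  shows "tangent_space unitary_group A = (**) A ` skew_hermitian"
proof (intro equalityI subsetI)
  interpret mm: bounded_bilinear "(**) :: complex^'n^'n \<Rightarrow> complex^'n^'n \<Rightarrow> complex^'n^'n"
    by (rule bounded_bilinear_matrix_mult)
  fix V assume "V \<in> tangent_space unitary_group A"
  then obtain c :: "real \<Rightarrow> complex^'n^'n" where c: "\<And>t. c t \<in> unitary_group" "c 0 = A"
    "(c has_vector_derivative V) (at 0)"
    by (auto simp: tangent_space_def)
  have "bounded_linear (ctranspose :: complex^'n^'n \<Rightarrow> _)"
    by (rule linear_conv_bounded_linear[THEN iffD1])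
      (auto intro!: linearI simp: ctranspose_add ctranspose_scaleR)
  from bounded_linear.has_vector_derivative[OF this c(3)]
  have "((\<lambda>t. ctranspose (c t)) has_vector_derivative ctranspose V) (at 0)" .
  from mm.has_vector_derivative[OF this c(3)]
  have "((\<lambda>t. ctranspose (c t) ** c t) has_vector_derivative
      ctranspose A ** V + ctranspose V ** A) (at 0)"
    by (simp add: c(2))
  moreover have "(\<lambda>t. ctranspose (c t) ** c t) = (\<lambda>t. mat 1)"
    using c(1) by (auto simp: unitary_group_def)
  ultimately have "ctranspose A ** V + ctranspose V ** A = 0"
    using vector_derivative_unique_at[OF _ has_vector_derivative_const] by metis
  then have "ctranspose A ** V \<in> skew_hermitian"
    by (simp add: skew_hermitian_def ctranspose_mult eq_neg_iff_add_eq_0 add.commute)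
  moreover have "V = A ** (ctranspose A ** V)"
    using A by (simp add: matrix_mul_assoc unitary_group_def)
  ultimately show "V \<in> (**) A ` skew_hermitian" by blast
next
  interpret mm: bounded_bilinear "(**) :: complex^'n^'n \<Rightarrow> complex^'n^'n \<Rightarrow> complex^'n^'n"
    by (rule bounded_bilinear_matrix_mult)
  fix V assume "V \<in> (**) A ` skew_hermitian"
  then obtain S where S: "S \<in> skew_hermitian" "V = A ** S" by blast
  define K where "K t = (t / 2) *\<^sub>R S" for t :: real
  have K: "K t \<in> skew_hermitian" for t
    using S by (simp add: K_def skew_hermitian_def ctranspose_scaleR)
  have "\<exists>B. (mat 1 - K t) ** B = mat 1 \<and> B ** (mat 1 - K t) = mat 1 \<and>
      (mat 1 + K t) ** B \<in> unitary_group" for t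
    using cayley_unitary[OF K] by metis
  then obtain B where B: "\<And>t. B t ** (mat 1 - K t) = mat 1"
    "\<And>t. (mat 1 + K t) ** B t \<in> unitary_group"
    by metis
  define c where "c t = A ** ((mat 1 + K t) ** B t)" for t
  have c_un: "c t \<in> unitary_group" for t
    unfolding c_def by (rule unitary_mult[OF A B(2)])
  have "c t ** (mat 1 - K t) = A ** (mat 1 + K t)" for t
    using B(1) by (simp add: c_def matrix_mul_assoc[symmetric])
  then have c_eq: "c t - A = (t / 2) *\<^sub>R ((c t + A) ** S)" for t
    by (simp add: mm.diff_right mm.add_right mm.add_left K_def mm.scaleR_right algebra_simps)
  have c0: "c 0 = A"
    using c_eq[of 0] by simp
  have "bounded (range (\<lambda>t. (c t + A) ** S))"
  proof -
    obtain r where r: "\<And>t. norm (c t) \<le> r"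
      using bounded_unitary c_un unfolding bounded_iff by blast
    obtain L where L: "\<And>(X :: complex^'n^'n) (Y :: complex^'n^'n). norm (X ** Y) \<le> norm X * norm Y * L" "L \<ge> 0"
      using mm.nonneg_bounded by blast
    have "norm ((c t + A) ** S) \<le> (r + norm A) * norm S * L" for t
      using r[of t] norm_triangle_ineq[of "c t" A] L
      by (intro order_trans[OF L(1)] mult_right_mono) auto
    then show ?thesis by (auto simp: bounded_iff)
  qed
  then obtain r where r: "\<And>t. norm ((c t + A) ** S) \<le> r"
    by (auto simp: bounded_iff)
  have "((\<lambda>t. (t / 2) *\<^sub>R ((c t + A) ** S)) \<longlongrightarrow> 0) (at 0)"
  proof (rule Lim_null_comparison)
    show "\<forall>\<^sub>F t in at 0. norm ((t / 2) *\<^sub>R ((c t + A) ** S)) \<le> \<bar>t\<bar> / 2 * r"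
      using r by (auto intro!: always_eventually mult_left_mono)
    show "((\<lambda>t. \<bar>t\<bar> / 2 * r) \<longlongrightarrow> 0) (at 0)"
      by (auto intro!: tendsto_eq_intros)
  qed
  then have "((\<lambda>t. c t - A) \<longlongrightarrow> 0) (at 0)"
    by (simp add: c_eq)
  then have "(c \<longlongrightarrow> A) (at 0)"
    by (simp add: LIM_zero_iff)
  then have "((\<lambda>t. (1/2) *\<^sub>R ((c t + A) ** S)) \<longlongrightarrow> (1/2) *\<^sub>R ((A + A) ** S)) (at 0)"
    by (intro tendsto_intros mm.tendsto)
  then have "((\<lambda>t. (1/2) *\<^sub>R ((c t + A) ** S)) \<longlongrightarrow> V) (at 0)"
    by (simp add: S(2) scaleR_2[symmetric] mm.scaleR_left)
  then have "((\<lambda>t. norm ((1/2) *\<^sub>R ((c t + A) ** S) - V)) \<longlongrightarrow> 0) (at 0)"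
    by (simp add: LIM_zero_iff tendsto_norm_zero_iff)
  then have "((\<lambda>t. norm ((c t - c 0) - (t - 0) *\<^sub>R V) / norm (t - 0)) \<longlongrightarrow> 0) (at 0)"
  proof (rule Lim_transform_eventually)
    have "norm ((1/2) *\<^sub>R ((c t + A) ** S) - V) = norm ((c t - c 0) - (t - 0) *\<^sub>R V) / norm (t - 0)"
      if "t \<noteq> 0" for t
    proof -
      have "(c t - c 0) - (t - 0) *\<^sub>R V = t *\<^sub>R ((1/2) *\<^sub>R ((c t + A) ** S) - V)"
        by (simp add: c0 c_eq scaleR_diff_right)
      then show ?thesis using that by simp
    qed
    then show "\<forall>\<^sub>F t in at 0. norm ((1/2) *\<^sub>R ((c t + A) ** S) - V) =
        norm ((c t - c 0) - (t - 0) *\<^sub>R V) / norm (t - 0)"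
      by (auto simp: eventually_at intro!: exI[of _ 1])
  qed
  then have "(c has_vector_derivative V) (at 0)"
    by (simp add: has_vector_derivative_def has_derivative_iff_norm bounded_linear_scaleR_left)
  then show "V \<in> tangent_space unitary_group A"
    using c_un c0 by (auto simp: tangent_space_def)
qed

abbreviation U3 :: "(complex^3^3) set" where
  "U3 \<equiv> unitary_group"

definition E_mat :: "3 \<Rightarrow> 3 \<Rightarrow> complex^3^3" where
  "E_mat i j = axis i (axis j 1)"

definition X_mat :: "3 \<Rightarrow> 3 \<Rightarrow> complex^3^3" where
  "X_mat i j = E_mat i j - E_mat j i"

definition Y_mat :: "3 \<Rightarrow> 3 \<Rightarrow> complex^3^3" where
  "Y_mat i j = mat \<i> ** (E_mat i j + E_mat j i)"

definition xi_mat :: "3 \<Rightarrow> complex^3^3" where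
  "xi_mat i = mat \<i> ** E_mat i i"

text \<open>The elements of the type \<open>3\<close> are \<open>1\<close>, \<open>2\<close> and \<open>3\<close>, where \<open>3 = 0\<close>; the pairs are therefore
  listed instead of being described by an order.\<close>

definition pairs :: "(3 \<times> 3) set" where
  "pairs = {(1, 2), (1, 3), (2, 3)}"

definition frame :: "(complex^3^3) set" where
  "frame = (\<lambda>(i, j). X_mat i j) ` pairs \<union> (\<lambda>(i, j). Y_mat i j) ` pairs \<union> range xi_mat"

text \<open>Coordinates on the Lie algebra with respect to the basis \<open>frame\<close>; the frame is a real basis
  of the skew-Hermitian matrices by \<open>independent_frame\<close> and \<open>span_frame\<close>.\<close>

definition coord :: "complex^3^3 \<Rightarrow> complex^3^3 \<Rightarrow> real" where
  "coord b V = representation frame V b"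

lemma frame_eq:
  "frame = {X_mat 1 2, X_mat 1 3, X_mat 2 3, Y_mat 1 2, Y_mat 1 3, Y_mat 2 3,
    xi_mat 1, xi_mat 2, xi_mat 3}"
  by (simp add: frame_def pairs_def UNIV_3 insert_commute)

lemma E_mat_nth: "E_mat i j $ a $ b = (if a = i \<and> b = j then 1 else 0)"
  by (simp add: E_mat_def axis_def)

lemma mat_mult_nth: "(mat c ** A) $ a $ b = c * A $ a $ b"
  by (simp add: matrix_matrix_mult_def mat_def if_distrib[of "\<lambda>x. x * _"] cong: if_cong)

lemmas frame_nth = X_mat_def Y_mat_def xi_mat_def E_mat_nth mat_mult_nth

lemma pairwise_orthogonal_frame: "pairwise orthogonal frame"
proof -
  have "\<forall>x\<in>frame. \<forall>y\<in>frame. x = y \<or> x \<bullet> y = 0"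
    by (simp add: frame_eq inner_vec_def sum_3 frame_nth inner_complex_def)
  then show ?thesis by (auto simp: pairwise_def orthogonal_def)
qed

lemma zero_notin_frame: "0 \<notin> frame"
  by (auto simp: frame_eq vec_eq_iff forall_3 frame_nth)

lemma independent_frame: "independent frame"
  using pairwise_orthogonal_frame zero_notin_frame by (rule pairwise_orthogonal_independent)

lemma span_frame: "span frame = skew_hermitian"
proof (intro equalityI subsetI)
  have "subspace skew_hermitian"
    by (auto simp: subspace_def skew_hermitian_def ctranspose_add ctranspose_scaleR
        ctranspose_def vec_eq_iff)
  moreover have "frame \<subseteq> skew_hermitian"
    by (simp add: frame_eq skew_hermitian_def vec_eq_iff forall_3 ctranspose_def frame_nth)
  ultimately show "V \<in> skew_hermitian" if "V \<in> span frame" for V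
    using that span_minimal by blast
next
  fix V :: "complex^3^3" assume "V \<in> skew_hermitian"
  then have V: "cnj (V $ j $ i) = - V $ i $ j" for i j
    by (auto simp: skew_hermitian_def ctranspose_def vec_eq_iff)
  have Re: "Re (V $ j $ i) = - Re (V $ i $ j)" and Im: "Im (V $ j $ i) = Im (V $ i $ j)" for i j
    using V[of j i] by (auto simp: complex_eq_iff)
  have "V = Re (V $ 1 $ 2) *\<^sub>R X_mat 1 2 + Im (V $ 1 $ 2) *\<^sub>R Y_mat 1 2 +
      Re (V $ 1 $ 3) *\<^sub>R X_mat 1 3 + Im (V $ 1 $ 3) *\<^sub>R Y_mat 1 3 +
      Re (V $ 2 $ 3) *\<^sub>R X_mat 2 3 + Im (V $ 2 $ 3) *\<^sub>R Y_mat 2 3 +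
      Im (V $ 1 $ 1) *\<^sub>R xi_mat 1 + Im (V $ 2 $ 2) *\<^sub>R xi_mat 2 + Im (V $ 3 $ 3) *\<^sub>R xi_mat 3"
    using Re[of 1 1] Re[of 2 2] Re[of 3 3] Re[of 1 2] Re[of 1 3] Re[of 2 3]
      Im[of 1 2] Im[of 1 3] Im[of 2 3]
    by (simp add: vec_eq_iff forall_3 frame_nth complex_eq_iff)
  also have "\<dots> \<in> span frame"
    by (intro span_add span_scale span_base) (auto simp: frame_eq)
  finally show "V \<in> span frame" .
qed

lemma coord_frame: "b' \<in> frame \<Longrightarrow> coord b b' = (if b = b' then 1 else 0)"
  by (simp add: coord_def representation_basis[OF independent_frame])

text \<open>The differential at the identity of left translation by \<open>A\<close> is \<open>V \<mapsto> A ** V\<close>, so a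
  tangent vector \<open>V\<close> at \<open>A\<close> is brought back to the Lie algebra as \<open>matrix_inv A ** V\<close>.\<close>

definition \<xi>_U3 :: "3 \<Rightarrow> complex^3^3 \<Rightarrow> complex^3^3" where
  "\<xi>_U3 i A = A ** xi_mat i"

definition g_U3 :: "complex^3^3 \<Rightarrow> complex^3^3 \<Rightarrow> complex^3^3 \<Rightarrow> real" where
  "g_U3 A V W = (\<Sum>b\<in>frame. coord b (matrix_inv A ** V) * coord b (matrix_inv A ** W))"

definition \<eta>_U3 :: "3 \<Rightarrow> complex^3^3 \<Rightarrow> complex^3^3 \<Rightarrow> real" where
  "\<eta>_U3 i A V = g_U3 A (\<xi>_U3 i A) V"

definition phi_id :: "complex^3^3 \<Rightarrow> complex^3^3" where
  "phi_id V = (\<Sum>(i, j)\<in>pairs. coord (X_mat i j) V *\<^sub>R Y_mat i j - coord (Y_mat i j) V *\<^sub>R X_mat i j)"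

definition \<phi>_U3 :: "complex^3^3 \<Rightarrow> complex^3^3 \<Rightarrow> complex^3^3" where
  "\<phi>_U3 A V = A ** phi_id (matrix_inv A ** V)"

lemma matrix_inv_mult_unitary:
  assumes "A \<in> unitary_group"
  shows "matrix_inv A ** (A ** V) = V"
  using assms by (simp add: matrix_inv_unitary matrix_mul_assoc unitary_group_def)

lemma g_U3_orthonormal:
  assumes "A \<in> U3" "b \<in> frame" "b' \<in> frame"
  shows "g_U3 A (A ** b) (A ** b') = (if b = b' then 1 else 0)"
proof -
  have "g_U3 A (A ** b) (A ** b') = (\<Sum>c\<in>frame. if c = b \<and> c = b' then 1 else 0)"
    using assms by (auto simp: g_U3_def matrix_inv_mult_unitary coord_frame intro!: sum.cong)
  also have "\<dots> = (\<Sum>c\<in>frame. if c = b then if b = b' then 1 else 0 else 0)"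
    by (rule sum.cong) auto
  also have "\<dots> = (if b = b' then 1 else 0)"
    using assms by (subst sum.delta) (auto simp: frame_eq)
  finally show ?thesis .
qed

lemma distinct_frame:
  "distinct [X_mat 1 2, X_mat 1 3, X_mat 2 3, Y_mat 1 2, Y_mat 1 3, Y_mat 2 3,
    xi_mat 1, xi_mat 2, xi_mat 3]"
  by (simp add: vec_eq_iff forall_3 frame_nth)

lemma phi_id_frame:
  shows "(i, j) \<in> pairs \<Longrightarrow> phi_id (X_mat i j) = Y_mat i j"
    and "(i, j) \<in> pairs \<Longrightarrow> phi_id (Y_mat i j) = - X_mat i j"
    and "phi_id (xi_mat k) = 0"
proof -
  note neq = distinct_frame[simplified] distinct_frame[THEN distinct_rev[THEN iffD2], simplified]
  have mem: "X_mat 1 2 \<in> frame" "X_mat 1 3 \<in> frame" "X_mat 2 3 \<in> frame"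
    "Y_mat 1 2 \<in> frame" "Y_mat 1 3 \<in> frame" "Y_mat 2 3 \<in> frame"
    "xi_mat 1 \<in> frame" "xi_mat 2 \<in> frame" "xi_mat 3 \<in> frame"
    by (simp_all add: frame_eq)
  show "(i, j) \<in> pairs \<Longrightarrow> phi_id (X_mat i j) = Y_mat i j"
    and "(i, j) \<in> pairs \<Longrightarrow> phi_id (Y_mat i j) = - X_mat i j"
    by (auto simp: phi_id_def pairs_def coord_frame mem neq)
  show "phi_id (xi_mat k) = 0"
    using exhaust_3[of k] by (auto simp: phi_id_def pairs_def coord_frame mem neq)
qed

lemma \<phi>_U3_frame:
  assumes "A \<in> U3"
  shows "(i, j) \<in> pairs \<Longrightarrow> \<phi>_U3 A (A ** X_mat i j) = A ** Y_mat i j"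
    and "(i, j) \<in> pairs \<Longrightarrow> \<phi>_U3 A (A ** Y_mat i j) = - (A ** X_mat i j)"
    and "\<phi>_U3 A (A ** xi_mat k) = 0"
  using assms
  by (simp_all add: \<phi>_U3_def matrix_inv_mult_unitary phi_id_frame
      bounded_bilinear.minus_right[OF bounded_bilinear_matrix_mult]
      bounded_bilinear.zero_right[OF bounded_bilinear_matrix_mult])

end

theory Submission
  imports Defs
begin

text \<open>Every tangent vector of the unitary group at \<open>A\<close> is \<open>A ** S\<close> for a unique skew-Hermitian
  \<open>S\<close>, so a vector field is \<open>X q = q ** a q\<close> with a smooth skew-Hermitian valued function \<open>a\<close>.
  The structure tensors are left-invariant: in this trivialisation \<open>\<phi>\<close>, \<open>\<eta>\<^sub>i\<close> and \<open>g\<close> are fixed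
  linear and bilinear maps on the Lie algebra. The axioms of a metric f-structure thereby become
  statements about skew-Hermitian matrices, and the required smoothness of \<open>\<phi> X\<close>, \<open>\<eta>\<^sub>i(X)\<close> and
  \<open>g(X, Y)\<close> follows because these arise from \<open>a\<close> by linear and bilinear operations.

  For normality, the Lie bracket of \<open>q ** a q\<close> and \<open>q ** b q\<close> consists of the matrix commutator
  of \<open>a\<close> and \<open>b\<close> and of derivatives of \<open>a\<close> and \<open>b\<close> (\<open>lie_bracket_translate\<close>). In \<open>N\<^sup>(\<^sup>1\<^sup>)\<close>
  the derivatives cancel, as they must for a tensor, and what remains is an algebraic expression
  in the values of \<open>a\<close> and \<open>b\<close> at the point (\<open>N1_left_invariant\<close>).

  On the Lie algebra \<open>\<phi>\<close> multiplies the entries above the diagonal by \<open>\<i>\<close>, those below it by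
  \<open>- \<i>\<close>, and kills the diagonal (\<open>phi_id_skew_hermitian\<close>). This makes sense for all complex
  matrices, and its \<open>\<i>\<close>- and \<open>- \<i>\<close>-eigenspaces there are the strictly upper and lower
  triangular matrices, which are subalgebras normalised by the commuting diagonal matrices. So the
  Nijenhuis expression can only come from commutators of an upper with a lower triangular matrix,
  and there it is their diagonal part (\<open>phi_matrix_nijenhuis\<close>). As \<open>d\<eta>\<^sub>i(X, Y)\<close> is
  \<open>- \<eta>\<^sub>i([X, Y])\<close> on left-invariant fields, the sum of the \<open>d\<eta>\<^sub>i \<otimes> \<xi>\<^sub>i\<close> is minus that
  diagonal part.\<close>

section \<open>Smooth maps are closed under linear and bilinear operations\<close>

lemma Ck_on_cong:
  assumes "open W" "\<And>x. x \<in> W \<Longrightarrow> f x = g x" "Ck_on k W f"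
  shows "Ck_on k W g"
  using assms(2,3)
proof (induction k arbitrary: f g)
  case 0
  then show ?case by (simp cong: continuous_on_cong_simp)
next
  case (Suc k)
  have D: "(g has_derivative frechet_derivative f (at x)) (at x)" if "x \<in> W" for x
  proof -
    have "(f has_derivative frechet_derivative f (at x)) (at x)"
      using Suc.prems that by (simp add: frechet_derivative_works)
    then show ?thesis
      by (rule has_derivative_transform_within_open[OF _ \<open>open W\<close> that Suc.prems(1)])
  qed
  have eq: "frechet_derivative f (at x) v = frechet_derivative g (at x) v" if "x \<in> W" for x v
    using frechet_derivative_at[OF D[OF that]] by simp
  have "Ck_on k W (\<lambda>x. frechet_derivative g (at x) v)" for v
    using Suc.prems(2) by (intro Suc.IH[OF eq]) auto
  then show ?case
    using D by (auto simp: differentiable_def)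
qed

lemma Ck_on_subset: "Ck_on k W f \<Longrightarrow> V \<subseteq> W \<Longrightarrow> Ck_on k V f"
  by (induction k arbitrary: f) (auto intro: continuous_on_subset)

lemma Ck_on_SucD: "Ck_on (Suc k) W f \<Longrightarrow> Ck_on k W f"
proof (induction k arbitrary: f)
  case 0
  then have "isCont f x" if "x \<in> W" for x
    using that by (intro differentiable_imp_continuous_within) simp
  then show ?case
    by (simp add: continuous_at_imp_continuous_on)
next
  case (Suc k)
  note f = Suc.prems[unfolded Ck_on.simps(2)[of "Suc k"]]
  have "Ck_on k W (\<lambda>x. frechet_derivative f (at x) v)" for v
    by (rule Suc.IH[OF f[THEN conjunct2, THEN spec]])
  then show ?case
    using f[THEN conjunct1] unfolding Ck_on.simps(2)[of k] by (intro conjI allI)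
qed

lemma Ck_on_bounded_linear:
  assumes L: "bounded_linear L" and "open W" "Ck_on k W f"
  shows "Ck_on k W (\<lambda>x. L (f x))"
  using assms(3)
proof (induction k arbitrary: f)
  case 0
  then show ?case using L by (simp add: bounded_linear.continuous_on)
next
  case (Suc k)
  have D: "((\<lambda>x. L (f x)) has_derivative (\<lambda>v. L (frechet_derivative f (at x) v))) (at x)"
    if "x \<in> W" for x
    using Suc.prems that
    by (intro bounded_linear.has_derivative[OF L]) (simp add: frechet_derivative_works)
  have "Ck_on k W (\<lambda>x. L (frechet_derivative f (at x) v))" for v
    using Suc.prems by (intro Suc.IH) simp
  then have "Ck_on k W (\<lambda>x. frechet_derivative (\<lambda>x. L (f x)) (at x) v)" for v
    by (rule Ck_on_cong[OF \<open>open W\<close>, rotated]) (simp add: frechet_derivative_at[OF D, symmetric])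
  then show ?case using D by (auto simp: differentiable_def)
qed

lemma Ck_on_add:
  assumes "open W" "Ck_on k W f" "Ck_on k W g"
  shows "Ck_on k W (\<lambda>x. f x + g x)"
  using assms(2,3)
proof (induction k arbitrary: f g)
  case 0
  then show ?case by (simp add: continuous_on_add)
next
  case (Suc k)
  have D: "((\<lambda>x. f x + g x) has_derivative
      (\<lambda>v. frechet_derivative f (at x) v + frechet_derivative g (at x) v)) (at x)"
    if "x \<in> W" for x
    using Suc.prems that by (intro has_derivative_add) (simp_all add: frechet_derivative_works)
  have "Ck_on k W (\<lambda>x. frechet_derivative f (at x) v + frechet_derivative g (at x) v)" for v
    using Suc.prems by (intro Suc.IH) simp_all
  then have "Ck_on k W (\<lambda>x. frechet_derivative (\<lambda>x. f x + g x) (at x) v)" for v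
    by (rule Ck_on_cong[OF \<open>open W\<close>, rotated]) (simp add: frechet_derivative_at[OF D, symmetric])
  then show ?case using D by (auto simp: differentiable_def)
qed

lemma Ck_on_bilinear:
  assumes B: "bounded_bilinear B" and "open W" "Ck_on k W f" "Ck_on k W g"
  shows "Ck_on k W (\<lambda>x. B (f x) (g x))"
  using assms(3,4)
proof (induction k arbitrary: f g)
  case 0
  then show ?case using B by (simp add: bounded_bilinear.continuous_on)
next
  case (Suc k)
  have D: "((\<lambda>x. B (f x) (g x)) has_derivative
      (\<lambda>v. B (f x) (frechet_derivative g (at x) v) + B (frechet_derivative f (at x) v) (g x)))
      (at x)"
    if "x \<in> W" for x
    using Suc.prems that by (intro bounded_bilinear.FDERIV[OF B])
      (simp_all add: frechet_derivative_works)
  have "Ck_on k W (\<lambda>x. B (f x) (frechet_derivative g (at x) v) +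
      B (frechet_derivative f (at x) v) (g x))" for v
    using Suc.prems Ck_on_SucD[OF Suc.prems(1)] Ck_on_SucD[OF Suc.prems(2)]
    by (intro Ck_on_add[OF \<open>open W\<close> Suc.IH Suc.IH]) simp_all
  then have "Ck_on k W (\<lambda>x. frechet_derivative (\<lambda>x. B (f x) (g x)) (at x) v)" for v
    by (rule Ck_on_cong[OF \<open>open W\<close>, rotated]) (simp add: frechet_derivative_at[OF D, symmetric])
  then show ?case using D by (auto simp: differentiable_def)
qed

lemma smooth_on_cong:
  assumes "\<And>q. q \<in> M \<Longrightarrow> f q = g q" "smooth_on M f"
  shows "smooth_on M g"
  unfolding smooth_on_def
proof
  fix p assume "p \<in> M"
  then obtain W h where "open W" "p \<in> W" "\<forall>k. Ck_on k W h" "\<forall>q\<in>M \<inter> W. h q = f q"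
    using assms(2) by (auto simp: smooth_on_def)
  then show "\<exists>W h. open W \<and> p \<in> W \<and> (\<forall>k. Ck_on k W h) \<and> (\<forall>q\<in>M \<inter> W. h q = g q)"
    using assms(1) by (intro exI[of _ W] exI[of _ h]) auto
qed

lemma smooth_on_bounded_linear:
  assumes L: "bounded_linear L" and f: "smooth_on M f"
  shows "smooth_on M (\<lambda>q. L (f q))"
  unfolding smooth_on_def
proof
  fix p assume "p \<in> M"
  then obtain W h where "open W" "p \<in> W" "\<forall>k. Ck_on k W h" "\<forall>q\<in>M \<inter> W. h q = f q"
    using f by (auto simp: smooth_on_def)
  then show "\<exists>W h. open W \<and> p \<in> W \<and> (\<forall>k. Ck_on k W h) \<and> (\<forall>q\<in>M \<inter> W. h q = L (f q))"
    by (intro exI[of _ W] exI[of _ "\<lambda>q. L (h q)"]) (auto intro: Ck_on_bounded_linear[OF L])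
qed

lemma smooth_on_bilinear:
  assumes B: "bounded_bilinear B" and f: "smooth_on M f" and g: "smooth_on M g"
  shows "smooth_on M (\<lambda>q. B (f q) (g q))"
  unfolding smooth_on_def
proof
  fix p assume p: "p \<in> M"
  obtain W h where W: "open W" "p \<in> W" "\<forall>k. Ck_on k W h" "\<forall>q\<in>M \<inter> W. h q = f q"
    using f p by (auto simp: smooth_on_def)
  obtain W' h' where W': "open W'" "p \<in> W'" "\<forall>k. Ck_on k W' h'" "\<forall>q\<in>M \<inter> W'. h' q = g q"
    using g p by (auto simp: smooth_on_def)
  have "Ck_on k (W \<inter> W') (\<lambda>q. B (h q) (h' q))" for k
    using W W' by (intro Ck_on_bilinear[OF B]) (auto intro: Ck_on_subset)
  with W W' show "\<exists>W h. open W \<and> p \<in> W \<and> (\<forall>k. Ck_on k W h) \<and>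
      (\<forall>q\<in>M \<inter> W. h q = B (f q) (g q))"
    by (intro exI[of _ "W \<inter> W'"] exI[of _ "\<lambda>q. B (h q) (h' q)"]) auto
qed

lemma smooth_on_add:
  assumes f: "smooth_on M f" and g: "smooth_on M g"
  shows "smooth_on M (\<lambda>q. f q + g q)"
  unfolding smooth_on_def
proof
  fix p assume p: "p \<in> M"
  obtain W h where W: "open W" "p \<in> W" "\<forall>k. Ck_on k W h" "\<forall>q\<in>M \<inter> W. h q = f q"
    using f p by (auto simp: smooth_on_def)
  obtain W' h' where W': "open W'" "p \<in> W'" "\<forall>k. Ck_on k W' h'" "\<forall>q\<in>M \<inter> W'. h' q = g q"
    using g p by (auto simp: smooth_on_def)
  have "Ck_on k (W \<inter> W') (\<lambda>q. h q + h' q)" for k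
    using W W' by (intro Ck_on_add) (auto intro: Ck_on_subset)
  with W W' show "\<exists>W h. open W \<and> p \<in> W \<and> (\<forall>k. Ck_on k W h) \<and> (\<forall>q\<in>M \<inter> W. h q = f q + g q)"
    by (intro exI[of _ "W \<inter> W'"] exI[of _ "\<lambda>q. h q + h' q"]) auto
qed

lemma smooth_on_sum:
  assumes "finite I" "\<And>i. i \<in> I \<Longrightarrow> smooth_on M (f i)"
  shows "smooth_on M (\<lambda>q. \<Sum>i\<in>I. f i q)"
  using assms
  by (induction I rule: finite_induct)
    (auto intro: smooth_on_add smooth_on_linear bounded_linear_zero)

section \<open>Vector fields on the unitary group in the left trivialisation\<close>

interpretation mm: bounded_bilinear
  "(**) :: complex^'n^'n \<Rightarrow> complex^'n^'n \<Rightarrow> complex^'n^'n"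
  by (rule bounded_bilinear_matrix_mult)

lemma bounded_linear_ctranspose:
  "bounded_linear (ctranspose :: complex^'n^'n \<Rightarrow> complex^'n^'n)"
  by (rule linear_conv_bounded_linear[THEN iffD1])
    (auto intro!: linearI simp: ctranspose_add ctranspose_scaleR)

lemma ctranspose_mult_cancel:
  assumes "A \<in> unitary_group"
  shows "ctranspose A ** (A ** V) = V" "A ** (ctranspose A ** V) = V"
  using assms by (simp_all add: matrix_mul_assoc unitary_group_def)

lemma subspace_skew_hermitian: "subspace (skew_hermitian :: (complex^'n^'n) set)"
  by (auto simp: subspace_def skew_hermitian_def ctranspose_add ctranspose_scaleR
      ctranspose_def vec_eq_iff)

lemma commutator_skew_hermitian:
  "U \<in> skew_hermitian \<Longrightarrow> V \<in> skew_hermitian \<Longrightarrow> U ** V - V ** U \<in> skew_hermitian"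
  by (simp add: skew_hermitian_def ctranspose_diff ctranspose_mult mm.minus_left mm.minus_right)

lemma tangent_unitary_iff:
  assumes "A \<in> unitary_group"
  shows "V \<in> tangent_space unitary_group A \<longleftrightarrow> ctranspose A ** V \<in> skew_hermitian"
proof
  show "ctranspose A ** V \<in> skew_hermitian" if "V \<in> tangent_space unitary_group A"
    using that assms by (auto simp: tangent_space_unitary ctranspose_mult_cancel)
  show "V \<in> tangent_space unitary_group A" if "ctranspose A ** V \<in> skew_hermitian"
    using imageI[OF that, of "(**) A"] assms
    by (simp add: tangent_space_unitary ctranspose_mult_cancel)
qed

lemma translate_tangent:
  assumes "A \<in> unitary_group" "S \<in> skew_hermitian"
  shows "A ** S \<in> tangent_space unitary_group A"
  using assms by (simp add: tangent_space_unitary)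

text \<open>Tensors such as \<open>\<phi>\<close> and \<open>g\<close> are given by \<open>coord\<close>, which is linear on the skew-Hermitian matrices
  only; here \<open>L\<close> is a linear extension to all matrices.\<close>

lemma tangent_linear_unitaryI:
  assumes p: "p \<in> unitary_group" and "bounded_linear L"
    and eq: "\<And>S. S \<in> skew_hermitian \<Longrightarrow> \<alpha> (p ** S) = L S"
  shows "tangent_linear unitary_group p \<alpha>"
  unfolding tangent_linear_def tangent_space_unitary[OF p]
proof (clarify)
  fix S T :: "complex^'a^'a" and a b :: real
  assume S: "S \<in> skew_hermitian" and T: "T \<in> skew_hermitian"
  have "a *\<^sub>R S + b *\<^sub>R T \<in> skew_hermitian"
    by (intro subspace_add[OF subspace_skew_hermitian] subspace_scale[OF subspace_skew_hermitian] S T)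
  from eq[OF this] eq[OF S] eq[OF T]
  show "\<alpha> (a *\<^sub>R (p ** S) + b *\<^sub>R (p ** T)) = a *\<^sub>R \<alpha> (p ** S) + b *\<^sub>R \<alpha> (p ** T)"
    using bounded_linear.linear[OF assms(2)]
    by (simp add: mm.add_right mm.scaleR_right linear_add linear_scale)
qed

lemma trivialise_vector_field:
  assumes "vector_field unitary_group X" "q \<in> unitary_group"
  shows "ctranspose q ** X q \<in> skew_hermitian" "q ** (ctranspose q ** X q) = X q"
  using assms by (auto simp: vector_field_def tangent_unitary_iff ctranspose_mult_cancel)

lemma smooth_on_trivialisation:
  assumes "vector_field unitary_group X"
  shows "smooth_on unitary_group (\<lambda>q. ctranspose q ** X q)"
  using assms smooth_on_bilinear[OF bounded_bilinear_matrix_mult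
      smooth_on_linear[OF bounded_linear_ctranspose], of unitary_group X]
  by (simp add: vector_field_def)

lemma vector_field_translate:
  assumes "smooth_on unitary_group a" "\<And>q. q \<in> unitary_group \<Longrightarrow> a q \<in> skew_hermitian"
  shows "vector_field unitary_group (\<lambda>q. q ** a q)"
  using assms
    smooth_on_bilinear[OF bounded_bilinear_matrix_mult smooth_on_linear[OF bounded_linear_ident],
      of unitary_group a]
  by (simp add: vector_field_def translate_tangent)

lemma dir_deriv_cong:
  assumes "\<And>q. q \<in> M \<Longrightarrow> f q = g q" "p \<in> M"
  shows "dir_deriv M f p v = dir_deriv M g p v"
proof -
  have "(f has_derivative D) (at p within M) \<longleftrightarrow> (g has_derivative D) (at p within M)" for D
    using assms by (metis has_derivative_transform)
  then show ?thesis by (simp add: dir_deriv_def frechet_derivative_def)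
qed

lemma lie_bracket_cong:
  assumes "\<And>q. q \<in> M \<Longrightarrow> X q = X' q" "\<And>q. q \<in> M \<Longrightarrow> Y q = Y' q" "p \<in> M"
  shows "lie_bracket M X Y p = lie_bracket M X' Y' p"
  using dir_deriv_cong[of M X X' p] dir_deriv_cong[of M Y Y' p] assms
  by (simp add: lie_bracket_def)

text \<open>The values of \<open>a\<close> satisfy the linear equation \<open>ctranspose S + S = 0\<close>; differentiating it along
  \<open>M\<close> gives the same equation for the derivative. Consequently the bracket of two fields on the
  unitary group is again tangent, and \<open>\<phi>\<close> and \<open>\<eta>\<^sub>i\<close> act on it by their formulas on the Lie
  algebra.\<close>

lemma derivative_skew_hermitian:
  assumes p: "p \<in> M" and v: "v \<in> tangent_space M p"
    and a: "\<And>q. q \<in> M \<Longrightarrow> a q \<in> skew_hermitian" "(a has_derivative a') (at p within M)"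
  shows "a' v \<in> skew_hermitian"
proof -
  have "((\<lambda>q. ctranspose (a q) + a q) has_derivative (\<lambda>v. ctranspose (a' v) + a' v))
      (at p within M)"
    by (intro has_derivative_add bounded_linear.has_derivative[OF bounded_linear_ctranspose] a)
  from dir_deriv_eq[OF p v this]
  have "ctranspose (a' v) + a' v = dir_deriv M (\<lambda>q. ctranspose (a q) + a q) p v" by simp
  also have "\<dots> = dir_deriv M (\<lambda>q. 0) p v"
    using a(1) p by (intro dir_deriv_cong) (auto simp: skew_hermitian_def)
  also have "\<dots> = 0"
    by (rule dir_deriv_eq[OF p v]) simp
  finally show ?thesis
    by (simp add: skew_hermitian_def eq_neg_iff_add_eq_0)
qed

text \<open>The product rule: the terms in which the factor \<open>q\<close> is differentiated give the commutator of
  \<open>a p\<close> and \<open>b p\<close>.\<close>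

lemma lie_bracket_translate:
  fixes p :: "complex^'n^'n"
  assumes p: "p \<in> unitary_group" and "a p \<in> skew_hermitian" "b p \<in> skew_hermitian"
    and a: "(a has_derivative a') (at p within unitary_group)"
    and b: "(b has_derivative b') (at p within unitary_group)"
  shows "lie_bracket unitary_group (\<lambda>q. q ** a q) (\<lambda>q. q ** b q) p =
    p ** (a p ** b p - b p ** a p + b' (p ** a p) - a' (p ** b p))"
proof -
  have *: "dir_deriv unitary_group (\<lambda>q. q ** f q) p (p ** S) = p ** f' (p ** S) + (p ** S) ** f p"
    if "(f has_derivative f') (at p within unitary_group)" "S \<in> skew_hermitian"
    for f f' :: "complex^'n^'n \<Rightarrow> complex^'n^'n" and S
    by (rule dir_deriv_eq[OF p translate_tangent[OF p that(2)]
          mm.FDERIV[OF has_derivative_ident that(1)]])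
  show ?thesis
    using assms unfolding lie_bracket_def
    by (simp add: *[OF a] *[OF b] mm.add_right mm.diff_right matrix_mul_assoc)
qed

text \<open>In the Nijenhuis tensor each derivative of a trivialised field occurs twice with opposite signs:
  for instance \<open>L (b' (p ** L U))\<close> comes from \<open>[\<phi> X, \<phi> Y]\<close> and from \<open>\<phi> [\<phi> X, Y]\<close>, since
  \<open>L\<close> is constant and commutes with differentiation. In \<open>d\<eta>\<^sub>i\<close> the derivatives of \<open>\<eta>\<^sub>i(X)\<close> and
  \<open>\<eta>\<^sub>i(Y)\<close> cancel against those in the bracket. Here \<open>L\<close>, \<open>e i\<close> and \<open>x i\<close> are the values at the
  identity of \<open>\<phi>\<close>, \<open>\<eta> i\<close> and the i-th characteristic field.\<close>

lemma N1_left_invariant: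
  fixes \<phi> :: "complex^'n^'n \<Rightarrow> complex^'n^'n \<Rightarrow> complex^'n^'n" and x :: "'i::finite \<Rightarrow> complex^'n^'n"
  assumes L: "bounded_linear L" "\<And>S. S \<in> skew_hermitian \<Longrightarrow> L S \<in> skew_hermitian"
    and e: "\<And>i. bounded_linear (e i)"
    and \<phi>: "\<And>q S. q \<in> unitary_group \<Longrightarrow> S \<in> skew_hermitian \<Longrightarrow> \<phi> q (q ** S) = q ** L S"
    and \<eta>: "\<And>i q S. q \<in> unitary_group \<Longrightarrow> S \<in> skew_hermitian \<Longrightarrow> \<eta> i q (q ** S) = e i S"
    and X: "vector_field unitary_group X" and Y: "vector_field unitary_group Y"
    and p: "p \<in> unitary_group"
  defines "U \<equiv> ctranspose p ** X p" and "V \<equiv> ctranspose p ** Y p"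
  shows "N1 unitary_group \<phi> (\<lambda>i q. q ** x i) \<eta> X Y p =
    p ** ((L U ** L V - L V ** L U) + L (L (U ** V - V ** U)) - L (U ** L V - L V ** U)
      - L (L U ** V - V ** L U) - (\<Sum>i\<in>UNIV. e i (U ** V - V ** U) *\<^sub>R x i))"
proof -
  let ?M = "unitary_group :: (complex^'n^'n) set"
  define a where "a q = ctranspose q ** X q" for q
  define b where "b q = ctranspose q ** Y q" for q
  have skew: "a q \<in> skew_hermitian" "b q \<in> skew_hermitian" if "q \<in> ?M" for q
    using X Y that by (auto simp: a_def b_def vector_field_def tangent_unitary_iff)
  have Xa: "X q = q ** a q" and Yb: "Y q = q ** b q" if "q \<in> ?M" for q
    using that by (simp_all add: a_def b_def ctranspose_mult_cancel)
  have ab: "a p = U" "b p = V" by (simp_all add: a_def b_def U_def V_def)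
  note UV = skew[OF p, unfolded ab] L(2)[OF skew(1)[OF p, unfolded ab]]
    L(2)[OF skew(2)[OF p, unfolded ab]]
  obtain a' where a': "(a has_derivative a') (at p within ?M)"
    using smooth_on_has_derivative[OF smooth_on_trivialisation[OF X] p] by (auto simp: a_def[abs_def])
  obtain b' where b': "(b has_derivative b') (at p within ?M)"
    using smooth_on_has_derivative[OF smooth_on_trivialisation[OF Y] p] by (auto simp: b_def[abs_def])
  note La' = bounded_linear.has_derivative[OF L(1) a'] and Lb' = bounded_linear.has_derivative[OF L(1) b']
  have \<phi>X: "\<phi> q (X q) = q ** L (a q)" and \<phi>Y: "\<phi> q (Y q) = q ** L (b q)" if "q \<in> ?M" for q
    using that by (simp_all add: Xa Yb \<phi> skew)
  have a's: "a' (p ** S) \<in> skew_hermitian" and b's: "b' (p ** S) \<in> skew_hermitian"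
    if "S \<in> skew_hermitian" for S
    using derivative_skew_hermitian[OF p translate_tangent[OF p that]] skew a' b' by blast+
  note comm = commutator_skew_hermitian
  note add = subspace_add[OF subspace_skew_hermitian]
  note diff = subspace_diff[OF subspace_skew_hermitian]
  have b1: "lie_bracket ?M (\<lambda>q. \<phi> q (X q)) (\<lambda>q. \<phi> q (Y q)) p =
      p ** (L U ** L V - L V ** L U + L (b' (p ** L U)) - L (a' (p ** L V)))"
    using lie_bracket_translate[OF p _ _ La' Lb'] UV
    by (subst lie_bracket_cong[OF \<phi>X \<phi>Y p]) (simp_all add: ab)
  have b2: "lie_bracket ?M X Y p = p ** (U ** V - V ** U + b' (p ** U) - a' (p ** V))"
    using lie_bracket_translate[OF p _ _ a' b'] UV
    by (subst lie_bracket_cong[OF Xa Yb p]) (simp_all add: ab)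
  have b3: "lie_bracket ?M X (\<lambda>q. \<phi> q (Y q)) p =
      p ** (U ** L V - L V ** U + L (b' (p ** U)) - a' (p ** L V))"
    using lie_bracket_translate[OF p _ _ a' Lb'] UV
    by (subst lie_bracket_cong[OF Xa \<phi>Y p]) (simp_all add: ab)
  have b4: "lie_bracket ?M (\<lambda>q. \<phi> q (X q)) Y p =
      p ** (L U ** V - V ** L U + b' (p ** L U) - L (a' (p ** V)))"
    using lie_bracket_translate[OF p _ _ La' b'] UV
    by (subst lie_bracket_cong[OF \<phi>X Yb p]) (simp_all add: ab)
  have nij: "nijenhuis ?M \<phi> X Y p = p ** ((L U ** L V - L V ** L U) + L (L (U ** V - V ** U))
      - L (U ** L V - L V ** U) - L (L U ** V - V ** L U))"
  proof -
    have "nijenhuis ?M \<phi> X Y p =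
      p ** (L U ** L V - L V ** L U + L (b' (p ** L U)) - L (a' (p ** L V)))
      + p ** L (L (U ** V - V ** U + b' (p ** U) - a' (p ** V)))
      - p ** L (U ** L V - L V ** U + L (b' (p ** U)) - a' (p ** L V))
      - p ** L (L U ** V - V ** L U + b' (p ** L U) - L (a' (p ** V)))"
      unfolding nijenhuis_def b1 b2 b3 b4
      using UV by (simp add: \<phi>[OF p] L(2) a's b's comm add diff)
    also have "\<dots> = p ** ((L U ** L V - L V ** L U) + L (L (U ** V - V ** U))
      - L (U ** L V - L V ** U) - L (L U ** V - V ** L U))"
      by (simp add: bounded_linear.linear[OF L(1)] linear_add linear_diff
          mm.add_right mm.diff_right algebra_simps)
    finally show ?thesis .
  qed
  have d\<eta>: "ext_deriv ?M (\<eta> i) X Y p = - e i (U ** V - V ** U)" for i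
  proof -
    note le = bounded_linear.linear[OF e[of i]]
    have dir: "dir_deriv ?M (\<lambda>q. \<eta> i q (Z q)) p (p ** S) = e i (c' (p ** S))"
      if "\<And>q. q \<in> ?M \<Longrightarrow> Z q = q ** c q" "\<And>q. q \<in> ?M \<Longrightarrow> c q \<in> skew_hermitian"
        "(c has_derivative c') (at p within ?M)" "S \<in> skew_hermitian" for Z c c' S
    proof -
      have "dir_deriv ?M (\<lambda>q. \<eta> i q (Z q)) p (p ** S) = dir_deriv ?M (\<lambda>q. e i (c q)) p (p ** S)"
        using that p by (intro dir_deriv_cong) (simp_all add: \<eta>)
      also have "\<dots> = e i (c' (p ** S))"
        by (intro dir_deriv_eq[OF p translate_tangent[OF p that(4)]]
            bounded_linear.has_derivative[OF e] that(3))
      finally show ?thesis .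
    qed
    have "ext_deriv ?M (\<eta> i) X Y p =
      e i (b' (p ** U)) - e i (a' (p ** V)) - e i (U ** V - V ** U + b' (p ** U) - a' (p ** V))"
      unfolding ext_deriv_def b2
      using UV dir[OF Yb skew(2) b' UV(1)] dir[OF Xa skew(1) a' UV(2)]
      by (simp add: Xa[OF p] Yb[OF p] ab \<eta>[OF p] a's b's comm add diff)
    then show ?thesis
      by (simp add: linear_add[OF le] linear_diff[OF le])
  qed
  show ?thesis
    unfolding N1_def nij d\<eta>
    by (simp add: mm.diff_right mm.add_right mm.sum_right mm.scaleR_right sum_negf)
qed

section \<open>The structure tensors on the Lie algebra\<close>

text \<open>The eigenvalue of \<open>\<phi>\<close>, extended complex linearly to all matrices, on \<open>E_mat i j\<close>: since
  \<open>X_mat i j\<close> is sent to \<open>Y_mat i j\<close> and \<open>X_mat i j - \<i> Y_mat i j = 2 E_mat i j\<close> for \<open>i < j\<close>, it is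
  \<open>\<i>\<close> above the diagonal.\<close>

definition root_weight :: "3 \<Rightarrow> 3 \<Rightarrow> complex" where
  "root_weight i j = (if (i, j) \<in> pairs then \<i> else if (j, i) \<in> pairs then - \<i> else 0)"

definition phi_matrix :: "complex^3^3 \<Rightarrow> complex^3^3" where
  "phi_matrix V = (\<chi> i j. root_weight i j * V $ i $ j)"

lemma root_weight_simps [simp]:
  "root_weight i i = 0" "root_weight 1 2 = \<i>" "root_weight 1 3 = \<i>" "root_weight 2 3 = \<i>"
  "root_weight 2 1 = - \<i>" "root_weight 3 1 = - \<i>" "root_weight 3 2 = - \<i>"
  using exhaust_3[of i] by (auto simp: root_weight_def pairs_def)

lemma cnj_root_weight: "cnj (root_weight j i) = root_weight i j"
  using exhaust_3[of i] exhaust_3[of j] by (elim disjE) simp_all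

text \<open>Suppose that \<open>i\<close> precedes \<open>k\<close>. Wherever \<open>j\<close> stands, it comes after \<open>i\<close> or before \<open>k\<close>, so that
  one of the other two weights equals \<open>root_weight i k\<close> and the product vanishes. This is
  the closure of the upper triangular matrices under products, and the case of \<open>k\<close> before \<open>i\<close> is
  symmetric. For \<open>i = k\<close> the product is \<open>\<i> * (- \<i>)\<close> unless \<open>j = i\<close>.\<close>

lemma root_weight_integrable:
  "(root_weight i j - root_weight i k) * (root_weight j k - root_weight i k) =
    (if i = k \<and> j \<noteq> i then 1 else 0)"
  using exhaust_3[of i] exhaust_3[of j] exhaust_3[of k] by (elim disjE) simp_all

lemma bounded_linear_phi_matrix: "bounded_linear phi_matrix"
  by (rule linear_conv_bounded_linear[THEN iffD1])
    (auto intro!: linearI simp: phi_matrix_def vec_eq_iff algebra_simps)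

lemma skew_hermitian_nth:
  assumes "V \<in> skew_hermitian"
  shows "Re (V $ j $ i) = - Re (V $ i $ j)" "Im (V $ j $ i) = Im (V $ i $ j)" "Re (V $ i $ i) = 0"
proof -
  have "cnj (V $ i $ j) = - V $ j $ i" for i j
    using assms by (auto simp: skew_hermitian_def ctranspose_def vec_eq_iff)
  from this[of i j] this[of i i] show "Re (V $ j $ i) = - Re (V $ i $ j)"
    "Im (V $ j $ i) = Im (V $ i $ j)" "Re (V $ i $ i) = 0"
    by (auto simp: complex_eq_iff)
qed

lemma phi_matrix_skew_hermitian:
  assumes "V \<in> skew_hermitian"
  shows "phi_matrix V \<in> skew_hermitian"
  using assms
  by (simp add: skew_hermitian_def phi_matrix_def ctranspose_def vec_eq_iff cnj_root_weight)

lemma finite_frame: "finite frame"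
  by (simp add: frame_eq)

lemma skew_hermitian_expand:
  assumes "V \<in> skew_hermitian"
  shows "V = (\<Sum>b\<in>frame. coord b V *\<^sub>R b)"
  using sum_representation_eq[OF independent_frame _ finite_frame order_refl] assms
  by (simp add: span_frame coord_def)

text \<open>Unlike \<open>coord b\<close>, which vanishes off the span of the frame, the right-hand side is linear on all
  matrices, so this exhibits the coordinates as smooth functions on the ambient space.\<close>

lemma coord_inner:
  assumes V: "V \<in> skew_hermitian" and b: "b \<in> frame"
  shows "coord b V = (V \<bullet> b) / (b \<bullet> b)"
proof -
  have "V \<bullet> b = (\<Sum>c\<in>frame. coord c V * (c \<bullet> b))"
    by (subst skew_hermitian_expand[OF V]) (simp add: inner_sum_left)
  also have "\<dots> = (\<Sum>c\<in>frame. if c = b then coord b V * (b \<bullet> b) else 0)"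
    using pairwise_orthogonal_frame b
    by (intro sum.cong) (auto simp: pairwise_def orthogonal_def)
  also have "\<dots> = coord b V * (b \<bullet> b)"
    using b finite_frame by simp
  finally show ?thesis
    using b zero_notin_frame by auto
qed

lemma coord_skew_hermitian:
  assumes V: "V \<in> skew_hermitian"
  shows "(i, j) \<in> pairs \<Longrightarrow> coord (X_mat i j) V = Re (V $ i $ j)"
    and "(i, j) \<in> pairs \<Longrightarrow> coord (Y_mat i j) V = Im (V $ i $ j)"
    and "coord (xi_mat i) V = Im (V $ i $ i)"
proof -
  note nth = skew_hermitian_nth[OF V]
  show "(i, j) \<in> pairs \<Longrightarrow> coord (X_mat i j) V = Re (V $ i $ j)"
    using nth(1)[of 1 2] nth(1)[of 1 3] nth(1)[of 2 3]
    by (auto simp: pairs_def coord_inner[OF V] frame_eq inner_vec_def sum_3 frame_nth inner_complex_def)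
  show "(i, j) \<in> pairs \<Longrightarrow> coord (Y_mat i j) V = Im (V $ i $ j)"
    using nth(2)[of 1 2] nth(2)[of 1 3] nth(2)[of 2 3]
    by (auto simp: pairs_def coord_inner[OF V] frame_eq inner_vec_def sum_3 frame_nth inner_complex_def)
  show "coord (xi_mat i) V = Im (V $ i $ i)"
    using exhaust_3[of i]
    by (auto simp: coord_inner[OF V] frame_eq inner_vec_def sum_3 frame_nth inner_complex_def)
qed

lemma phi_id_skew_hermitian:
  assumes V: "V \<in> skew_hermitian"
  shows "phi_id V = phi_matrix V"
proof -
  have "phi_id V = (\<Sum>(i, j)\<in>pairs. Re (V $ i $ j) *\<^sub>R Y_mat i j - Im (V $ i $ j) *\<^sub>R X_mat i j)"
    unfolding phi_id_def by (intro sum.cong) (auto simp: coord_skew_hermitian[OF V])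
  also have "\<dots> = phi_matrix V"
    using skew_hermitian_nth(1,2)[OF V, of 2 1] skew_hermitian_nth(1,2)[OF V, of 3 1]
      skew_hermitian_nth(1,2)[OF V, of 3 2]
    by (simp add: pairs_def phi_matrix_def vec_eq_iff forall_3 frame_nth complex_eq_iff)
  finally show ?thesis .
qed

lemma coord_product_sum:
  assumes V: "V \<in> skew_hermitian" and W: "W \<in> skew_hermitian"
  shows "(\<Sum>b\<in>frame. coord b V * coord b W) =
    (\<Sum>(i, j)\<in>pairs. Re (V $ i $ j) * Re (W $ i $ j) + Im (V $ i $ j) * Im (W $ i $ j)) +
    (\<Sum>i\<in>UNIV. Im (V $ i $ i) * Im (W $ i $ i))"
proof -
  have fr: "frame = set [X_mat 1 2, X_mat 1 3, X_mat 2 3, Y_mat 1 2, Y_mat 1 3, Y_mat 2 3,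
    xi_mat 1, xi_mat 2, xi_mat 3]"
    by (simp add: frame_eq)
  show ?thesis
    unfolding fr sum.distinct_set_conv_list[OF distinct_frame]
    by (simp add: pairs_def coord_skew_hermitian[OF V] coord_skew_hermitian[OF W] sum_3)
qed

lemma coord_xi_product_sum:
  assumes V: "V \<in> skew_hermitian"
  shows "(\<Sum>b\<in>frame. coord b (xi_mat i) * coord b V) = Im (V $ i $ i)"
proof -
  have xi: "xi_mat i \<in> frame" by (simp add: frame_def)
  then have "(\<Sum>b\<in>frame. coord b (xi_mat i) * coord b V) =
      (\<Sum>b\<in>frame. if b = xi_mat i then coord b V else 0)"
    by (intro sum.cong) (auto simp: coord_frame)
  also have "\<dots> = Im (V $ i $ i)"
    using xi finite_frame by (simp add: coord_skew_hermitian[OF V])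
  finally show ?thesis .
qed

lemma xi_mat_skew_hermitian: "xi_mat i \<in> skew_hermitian"
  unfolding span_frame[symmetric] by (rule span_base) (simp add: frame_def)

lemma phi_matrix_xi_mat: "phi_matrix (xi_mat i) = 0"
  by (auto simp: phi_matrix_def vec_eq_iff frame_nth)

lemma sum_xi_mat:
  assumes "\<And>i. Re (V $ i $ i) = 0"
  shows "(\<Sum>i\<in>UNIV. Im (V $ i $ i) *\<^sub>R xi_mat i) = (\<chi> i j. if i = j then V $ i $ j else 0)"
  using assms by (simp add: sum_3 vec_eq_iff forall_3 frame_nth complex_eq_iff)

text \<open>In the \<open>(i, k)\<close> entry of the left-hand side the terms through the middle index \<open>j\<close> carry the weight
  \<open>s i j * s j k + s i k * s i k - s i k * s j k - s i k * s i j\<close> for \<open>s = root_weight\<close>, which is the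
  product in \<open>root_weight_integrable\<close>. Hence off the diagonal everything cancels, and on the
  diagonal all terms survive except the one with \<open>j = i\<close>, whose contribution to a commutator is
  zero anyway.\<close>

lemma phi_matrix_nijenhuis:
  "phi_matrix U ** phi_matrix V - phi_matrix V ** phi_matrix U
    + phi_matrix (phi_matrix (U ** V - V ** U))
    - phi_matrix (U ** phi_matrix V - phi_matrix V ** U)
    - phi_matrix (phi_matrix U ** V - V ** phi_matrix U)
    = (\<chi> i j. if i = j then (U ** V - V ** U) $ i $ j else 0)" (is "?l = _")
proof -
  let ?s = root_weight
  have "?l $ i $ k = (if i = k then (U ** V - V ** U) $ i $ k else 0)" for i k
  proof -
    have "?l $ i $ k =
        (\<Sum>j\<in>UNIV. (U $ i $ j * V $ j $ k - V $ i $ j * U $ j $ k) *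
          ((?s i j - ?s i k) * (?s j k - ?s i k)))"
      by (simp add: phi_matrix_def matrix_matrix_mult_def sum_3 algebra_simps)
    also have "\<dots> = (if i = k then (U ** V - V ** U) $ i $ k else 0)"
      unfolding root_weight_integrable
      by (auto simp: matrix_matrix_mult_def sum_subtractf[symmetric] mult.commute intro!: sum.cong)
    finally show ?thesis .
  qed
  then show ?thesis by (simp add: vec_eq_iff)
qed

section \<open>The metric f-structure\<close>

lemma \<phi>_U3_translate:
  assumes "A \<in> U3" "S \<in> skew_hermitian"
  shows "\<phi>_U3 A (A ** S) = A ** phi_matrix S"
  using assms by (simp add: \<phi>_U3_def matrix_inv_mult_unitary phi_id_skew_hermitian)

lemma g_U3_translate:
  assumes "A \<in> U3"
  shows "g_U3 A (A ** S) (A ** T) = (\<Sum>b\<in>frame. coord b S * coord b T)"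
  using assms by (simp add: g_U3_def matrix_inv_mult_unitary)

lemma \<eta>_U3_translate:
  assumes "A \<in> U3" "S \<in> skew_hermitian"
  shows "\<eta>_U3 i A (A ** S) = Im (S $ i $ i)"
  using assms by (simp add: \<eta>_U3_def \<xi>_U3_def g_U3_translate coord_xi_product_sum)

lemma bounded_linear_Im_nth: "bounded_linear (\<lambda>S :: complex^'n^'m. Im (S $ i $ j))"
  by (rule bounded_linear_compose[OF bounded_linear_Im
        bounded_linear_compose[OF bounded_linear_vec_nth bounded_linear_vec_nth]])

lemma endo_field_U3: "endo_field U3 \<phi>_U3"
  unfolding endo_field_def
proof (intro conjI ballI allI impI)
  fix p :: "complex^3^3" assume p: "p \<in> U3"
  show "tangent_linear U3 p (\<phi>_U3 p)"
    by (rule tangent_linear_unitaryI[where L = "\<lambda>S. p ** phi_matrix S", OF p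
          bounded_linear_compose[OF mm.bounded_linear_right bounded_linear_phi_matrix]
          \<phi>_U3_translate[OF p]])
  show "\<phi>_U3 p ` tangent_space U3 p \<subseteq> tangent_space U3 p"
    using p by (auto simp: tangent_space_unitary \<phi>_U3_translate phi_matrix_skew_hermitian)
next
  fix X assume X: "vector_field U3 X"
  have "vector_field U3 (\<lambda>q. q ** phi_matrix (ctranspose q ** X q))"
    using X by (intro vector_field_translate smooth_on_bounded_linear[OF bounded_linear_phi_matrix]
      smooth_on_trivialisation phi_matrix_skew_hermitian trivialise_vector_field)
  moreover have "q ** phi_matrix (ctranspose q ** X q) = \<phi>_U3 q (X q)" if "q \<in> U3" for q
    using \<phi>_U3_translate[OF that trivialise_vector_field(1)[OF X that]]
    by (simp add: trivialise_vector_field[OF X that])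
  ultimately show "vector_field U3 (\<lambda>q. \<phi>_U3 q (X q))"
    unfolding vector_field_def using smooth_on_cong by (metis (no_types, lifting))
qed

lemma vector_field_\<xi>_U3: "vector_field U3 (\<xi>_U3 i)"
  unfolding vector_field_def \<xi>_U3_def
  by (auto intro!: smooth_on_linear mm.bounded_linear_left translate_tangent xi_mat_skew_hermitian)

lemma one_form_U3: "one_form U3 (\<eta>_U3 i)"
  unfolding one_form_def
proof (intro conjI ballI allI impI)
  fix p :: "complex^3^3" assume p: "p \<in> U3"
  show "tangent_linear U3 p (\<eta>_U3 i p)"
    by (rule tangent_linear_unitaryI[OF p bounded_linear_Im_nth \<eta>_U3_translate[OF p]])
next
  fix X assume X: "vector_field U3 X"
  have "Im ((ctranspose q ** X q) $ i $ i) = \<eta>_U3 i q (X q)" if "q \<in> U3" for q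
    using \<eta>_U3_translate[OF that trivialise_vector_field(1)[OF X that]]
    by (simp add: trivialise_vector_field[OF X that])
  then show "smooth_on U3 (\<lambda>p. \<eta>_U3 i p (X p))"
    by (rule smooth_on_cong)
      (simp_all add: smooth_on_bounded_linear[OF bounded_linear_Im_nth] smooth_on_trivialisation X)
qed

lemma bounded_linear_inner_quotient: "bounded_linear (\<lambda>V. (V \<bullet> b) / (b \<bullet> b))"
  by (rule bounded_linear_compose[OF bounded_linear_divide bounded_linear_inner_left])

lemma riemannian_metric_U3: "riemannian_metric U3 g_U3"
  unfolding riemannian_metric_def
proof (intro conjI ballI allI impI)
  fix p u :: "complex^3^3" assume p: "p \<in> U3" and u: "u \<in> tangent_space U3 p"
  then obtain S where S: "S \<in> skew_hermitian" "u = p ** S"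
    by (auto simp: tangent_space_unitary)
  show "tangent_linear U3 p (g_U3 p u)"
  proof (rule tangent_linear_unitaryI[OF p])
    show "bounded_linear (\<lambda>T. \<Sum>b\<in>frame. coord b S * ((T \<bullet> b) / (b \<bullet> b)))"
      by (rule bounded_linear_sum)
        (rule bounded_linear_compose[OF bounded_linear_mult_right bounded_linear_inner_quotient])
    show "g_U3 p u (p ** T) = (\<Sum>b\<in>frame. coord b S * ((T \<bullet> b) / (b \<bullet> b)))"
      if "T \<in> skew_hermitian" for T
      using that by (simp add: S(2) g_U3_translate[OF p] coord_inner)
  qed
  show "g_U3 p u v = g_U3 p v u" for v
    by (simp add: g_U3_def mult.commute)
  show "g_U3 p u u > 0" if "u \<noteq> 0"
  proof -
    have "S \<noteq> 0"
      using that S(2) by (auto simp: mm.zero_right)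
    have "\<exists>b\<in>frame. coord b S \<noteq> 0"
    proof (rule ccontr)
      assume "\<not> ?thesis"
      then have "(\<Sum>b\<in>frame. coord b S *\<^sub>R b) = 0"
        by (intro sum.neutral) simp
      with \<open>S \<noteq> 0\<close> show False
        using skew_hermitian_expand[OF S(1)] by simp
    qed
    then obtain b where b: "b \<in> frame" "coord b S \<noteq> 0"
      by blast
    then have "0 < (\<Sum>b\<in>frame. coord b S * coord b S)"
      by (intro sum_pos2[OF finite_frame b(1)]) (auto simp: zero_less_mult_iff)
    then show ?thesis by (simp add: S(2) g_U3_translate[OF p])
  qed
next
  fix X Y assume X: "vector_field U3 X" and Y: "vector_field U3 Y"
  have "smooth_on U3 (\<lambda>q. \<Sum>b\<in>frame. ((ctranspose q ** X q) \<bullet> b) / (b \<bullet> b) *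
      (((ctranspose q ** Y q) \<bullet> b) / (b \<bullet> b)))"
    by (rule smooth_on_sum[OF finite_frame smooth_on_bilinear[OF bounded_bilinear_mult
          smooth_on_bounded_linear[OF bounded_linear_inner_quotient smooth_on_trivialisation[OF X]]
          smooth_on_bounded_linear[OF bounded_linear_inner_quotient smooth_on_trivialisation[OF Y]]]])
  moreover have "(\<Sum>b\<in>frame. ((ctranspose q ** X q) \<bullet> b) / (b \<bullet> b) *
      (((ctranspose q ** Y q) \<bullet> b) / (b \<bullet> b))) = g_U3 q (X q) (Y q)" if "q \<in> U3" for q
    using that X Y
    by (simp add: g_U3_def matrix_inv_unitary coord_inner[symmetric] trivialise_vector_field)
  ultimately show "smooth_on U3 (\<lambda>p. g_U3 p (X p) (Y p))"
    by (intro smooth_on_cong[of U3 _ "\<lambda>p. g_U3 p (X p) (Y p)"])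
qed

text \<open>The weights off the diagonal are invertible, so \<open>\<phi>\<close> kills exactly the diagonal skew-Hermitian
  matrices.\<close>

lemma kernel_\<phi>_U3:
  assumes p: "p \<in> U3"
  shows "{v \<in> tangent_space U3 p. \<phi>_U3 p v = 0} = span (range (\<lambda>i. \<xi>_U3 i p))"
proof (intro equalityI subsetI)
  fix v assume "v \<in> {v \<in> tangent_space U3 p. \<phi>_U3 p v = 0}"
  then obtain S where S: "S \<in> skew_hermitian" "v = p ** S" "p ** phi_matrix S = 0"
    using p by (auto simp: tangent_space_unitary \<phi>_U3_translate)
  then have 0: "phi_matrix S = 0"
    using ctranspose_mult_cancel(1)[OF p, of "phi_matrix S"] by simp
  have "S = (\<Sum>i\<in>UNIV. Im (S $ i $ i) *\<^sub>R xi_mat i)"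
    using 0 skew_hermitian_nth(3)[OF S(1)]
    by (subst sum_xi_mat) (auto simp: phi_matrix_def vec_eq_iff forall_3)
  then have "v = (\<Sum>i\<in>UNIV. Im (S $ i $ i) *\<^sub>R \<xi>_U3 i p)"
    by (metis (no_types, lifting) S(2) \<xi>_U3_def mm.scaleR_right mm.sum_right sum.cong)
  then show "v \<in> span (range (\<lambda>i. \<xi>_U3 i p))"
    by (auto intro: span_sum span_scale span_base)
next
  fix v assume v: "v \<in> span (range (\<lambda>i. \<xi>_U3 i p))"
  note lin = bounded_linear.linear[OF bounded_linear_phi_matrix]
  have "subspace {v. ctranspose p ** v \<in> skew_hermitian \<and> phi_matrix (ctranspose p ** v) = 0}"
    using subspace_skew_hermitian
    by (auto simp: subspace_def mm.add_right mm.scaleR_right linear_0[OF lin] linear_add[OF lin]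
        linear_scale[OF lin])
  moreover have "range (\<lambda>i. \<xi>_U3 i p) \<subseteq>
      {v. ctranspose p ** v \<in> skew_hermitian \<and> phi_matrix (ctranspose p ** v) = 0}"
    using p by (auto simp: \<xi>_U3_def ctranspose_mult_cancel xi_mat_skew_hermitian phi_matrix_xi_mat)
  ultimately have "ctranspose p ** v \<in> skew_hermitian" "phi_matrix (ctranspose p ** v) = 0"
    using v span_minimal by blast+
  with \<phi>_U3_translate[OF p this(1)] p show "v \<in> {v \<in> tangent_space U3 p. \<phi>_U3 p v = 0}"
    by (simp add: tangent_unitary_iff ctranspose_mult_cancel)
qed

lemma phi_matrix_square:
  assumes "S \<in> skew_hermitian"
  shows "phi_matrix (phi_matrix S) = - S + (\<Sum>i\<in>UNIV. Im (S $ i $ i) *\<^sub>R xi_mat i)"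
  using skew_hermitian_nth(3)[OF assms]
  by (subst sum_xi_mat) (auto simp: phi_matrix_def vec_eq_iff forall_3)

text \<open>Multiplication of the off-diagonal entries by \<open>\<i>\<close> or \<open>- \<i>\<close> preserves their real inner product,
  and the diagonal part, measured by the \<open>\<eta>\<^sub>i\<close>, is lost.\<close>

lemma coord_product_sum_phi_matrix:
  assumes S: "S \<in> skew_hermitian" and T: "T \<in> skew_hermitian"
  shows "(\<Sum>b\<in>frame. coord b (phi_matrix S) * coord b (phi_matrix T)) =
    (\<Sum>b\<in>frame. coord b S * coord b T) - (\<Sum>i\<in>UNIV. Im (S $ i $ i) * Im (T $ i $ i))"
  by (simp add: coord_product_sum phi_matrix_skew_hermitian S T)
    (simp add: pairs_def phi_matrix_def)

lemma metric_f_structure_U3: "metric_f_structure U3 \<phi>_U3 \<xi>_U3 \<eta>_U3 g_U3"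
  unfolding metric_f_structure_def
proof (intro conjI allI ballI)
  fix p :: "complex^3^3" assume p: "p \<in> U3"
  show "{v \<in> tangent_space U3 p. \<phi>_U3 p v = 0} = span (range (\<lambda>i. \<xi>_U3 i p))"
    by (rule kernel_\<phi>_U3[OF p])
  show "\<eta>_U3 i p (\<xi>_U3 j p) = (if i = j then 1 else 0)" for i j
    unfolding \<xi>_U3_def \<eta>_U3_translate[OF p xi_mat_skew_hermitian] by (auto simp: frame_nth)
  fix u assume "u \<in> tangent_space U3 p"
  then obtain S where S: "S \<in> skew_hermitian" "u = p ** S"
    using p by (auto simp: tangent_space_unitary)
  note [simp] = \<phi>_U3_translate[OF p] \<eta>_U3_translate[OF p] phi_matrix_skew_hermitian S(1)
  show "\<eta>_U3 i p (\<phi>_U3 p u) = 0" for i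
    by (simp add: S(2)) (simp add: phi_matrix_def)
  show "\<phi>_U3 p (\<phi>_U3 p u) = - u + (\<Sum>i\<in>UNIV. \<eta>_U3 i p u *\<^sub>R \<xi>_U3 i p)"
    by (simp add: S(2) \<xi>_U3_def phi_matrix_square mm.add_right mm.diff_right mm.sum_right
        mm.scaleR_right mm.minus_right)
  fix v assume "v \<in> tangent_space U3 p"
  then obtain T where T: "T \<in> skew_hermitian" "v = p ** T"
    using p by (auto simp: tangent_space_unitary)
  show "g_U3 p (\<phi>_U3 p u) (\<phi>_U3 p v) = g_U3 p u v - (\<Sum>i\<in>UNIV. \<eta>_U3 i p u * \<eta>_U3 i p v)"
    by (simp add: S(2) T g_U3_translate[OF p] coord_product_sum_phi_matrix)
qed (rule endo_field_U3 vector_field_\<xi>_U3 one_form_U3 riemannian_metric_U3)+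

lemma normal_f_structure_U3: "normal_f_structure U3 \<phi>_U3 \<xi>_U3 \<eta>_U3"
  unfolding normal_f_structure_def
proof (intro allI impI ballI)
  fix X Y and p :: "complex^3^3"
  assume X: "vector_field U3 X" and Y: "vector_field U3 Y" and p: "p \<in> U3"
  define U where "U = ctranspose p ** X p"
  define V where "V = ctranspose p ** Y p"
  have "U ** V - V ** U \<in> skew_hermitian"
    unfolding U_def V_def
    by (intro commutator_skew_hermitian trivialise_vector_field X Y p)
  then have diag: "(\<Sum>i\<in>UNIV. Im ((U ** V - V ** U) $ i $ i) *\<^sub>R xi_mat i) =
      (\<chi> i j. if i = j then (U ** V - V ** U) $ i $ j else 0)"
    by (intro sum_xi_mat skew_hermitian_nth)
  have \<xi>: "\<xi>_U3 = (\<lambda>i q. q ** xi_mat i)"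
    by (simp add: fun_eq_iff \<xi>_U3_def)
  show "N1 U3 \<phi>_U3 \<xi>_U3 \<eta>_U3 X Y p = 0"
    unfolding \<xi>
    by (subst N1_left_invariant[OF bounded_linear_phi_matrix phi_matrix_skew_hermitian
          bounded_linear_Im_nth \<phi>_U3_translate \<eta>_U3_translate X Y p])
      (simp_all only: U_def[symmetric] V_def[symmetric] diag phi_matrix_nijenhuis diff_self mm.zero_right)
qed

theorem proposition5p18:
  shows "metric_f_structure U3 \<phi>_U3 \<xi>_U3 \<eta>_U3 g_U3 \<and>
         normal_f_structure U3 \<phi>_U3 \<xi>_U3 \<eta>_U3"
  using metric_f_structure_U3 normal_f_structure_U3 by (rule conjI)

end
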